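(* Let $\mathcal{X}$, $\mathcal{Y}$ and $\mathcal{Z}$ be three Hilbert spaces and let $A\subseteq \mathcal{X}\times\mathcal{Z}$ and $B\subseteq \mathcal{Y}\times\mathcal{Z}$ be two range space relations. Then $T=B^{-1}A$ is a range space operator which is a solution of the equation $A=BX$ (that is, $T=B^{-1}A$ is a range space operator and $A=BT$) if and only if $\mathrm{ran}(A)\subseteq \mathrm{ran}(B)$, $\mathrm{mul}(B)=\mathrm{mul}(A)$ and $\ker(B)=\{0\}$.
   Context: A linear relation in $\mathcal{X}\times\mathcal{Y}$ is a linear subspace $A\subseteq\mathcal{X}\times\mathcal{Y}$. One sets $\mathrm{dom}(A)=\{x:\exists y,\ (x,y)\in A\}$, $\mathrm{ran}(A)=\{y:\exists x,\ (x,y)\in A\}$, $\ker(A)=\{x:(x,0)\in A\}$, $\mathrm{mul}(A)=\{y:(0,y)\in A\}$, and $A^{-1}=\{(y,x):(x,y)\in A\}$. For linear relations $A\subseteq\mathcal{X}\times\mathcal{Y}$ and $B\subseteq\mathcal{Y}\times\mathcal{Z}$, the product is $BA=\{(x,z):\exists y\in\mathcal{Y},\ (x,y)\in A \text{ and } (y,z)\in B\}\subseteq\mathcal{X}\times\mathcal{Z}$. A linear relation $A$ is (the graph of) a linear operator, defined on $\mathrm{dom}(A)$, if and only if $\mathrm{mul}(A)=\{0\}$; linear operators are identified with their graphs. For Hilbert spaces $\mathcal{X},\mathcal{Y}$, a linear relation $A\subseteq\mathcal{X}\times\mathcal{Y}$ is a range space relation if there are a Hilbert space $\mathcal{W}$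 and a bounded linear operator $F:\mathcal{W}\to\mathcal{X}\times\mathcal{Y}$ (defined on all of $\mathcal{W}$) with $\mathrm{ran}(F)=A$. A range space operator in $\mathcal{X}\times\mathcal{Y}$ is a range space relation that is the graph of a linear operator. *)

theory Defs
  imports Complex_Main "HOL-Algebra.Module"
begin

section \<open>Hilbert spaces on carrier sets\<close>

text \<open>
  Hilbert spaces are modules (in the sense of HOL-Algebra) with an inner product. Carriers, rather
  than type classes, are used because the definition of a range space relation quantifies
  existentially over a Hilbert space. The scalar field \<open>K\<close> is \<open>\<real>\<close> or \<open>\<complex>\<close> (that is,
  \<open>K = UNIV\<close>), both viewed inside \<open>complex\<close>. The ring fields \<open>mult\<close> and \<open>one\<close> that
  the record inherits play no role.
\<close>

record 'v hspace = "(complex, 'v) module" +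
  hinner :: "'v \<Rightarrow> 'v \<Rightarrow> complex"

definition scalar_field :: "complex set \<Rightarrow> complex ring" where
  "scalar_field K = \<lparr>carrier = K, mult = (*), one = 1, zero = 0, add = (+)\<rparr>"

definition hnorm :: "'v hspace \<Rightarrow> 'v \<Rightarrow> real" where
  "hnorm V x = sqrt (Re (hinner V x x))"

locale hilbert_space = module "scalar_field K" V
  for K :: "complex set" and V :: "'v hspace" (structure) +
  assumes scalars: "K = \<real> \<or> K = UNIV"
    and hinner_in: "\<lbrakk>x \<in> carrier V; y \<in> carrier V\<rbrakk> \<Longrightarrow> hinner V x y \<in> K"
    and hinner_add_left: "\<lbrakk>x \<in> carrier V; y \<in> carrier V; z \<in> carrier V\<rbrakk> \<Longrightarrow>
      hinner V (x \<oplus> y) z = hinner V x z + hinner V y z"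
    and hinner_smult_left: "\<lbrakk>c \<in> K; x \<in> carrier V; y \<in> carrier V\<rbrakk> \<Longrightarrow>
      hinner V (c \<odot> x) y = c * hinner V x y"
    and hinner_commute: "\<lbrakk>x \<in> carrier V; y \<in> carrier V\<rbrakk> \<Longrightarrow> hinner V x y = cnj (hinner V y x)"
    and hinner_pos: "\<lbrakk>x \<in> carrier V; x \<noteq> \<zero>\<rbrakk> \<Longrightarrow> Re (hinner V x x) > 0"
    and complete: "\<lbrakk>\<And>n. s n \<in> carrier V;
        \<And>e. e > 0 \<Longrightarrow> \<exists>N. \<forall>m\<ge>N. \<forall>n\<ge>N. hnorm V (s m \<ominus> s n) < e\<rbrakk> \<Longrightarrow>
      \<exists>l\<in>carrier V. (\<lambda>n. hnorm V (s n \<ominus> l)) \<longlonglongrightarrow> 0"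

definition hprod :: "'x hspace \<Rightarrow> 'y hspace \<Rightarrow> ('x \<times> 'y) hspace" where
  "hprod X Y = \<lparr>carrier = carrier X \<times> carrier Y,
     mult = (\<lambda>_ _. undefined), one = undefined,
     zero = (\<zero>\<^bsub>X\<^esub>, \<zero>\<^bsub>Y\<^esub>),
     add = (\<lambda>p q. (fst p \<oplus>\<^bsub>X\<^esub> fst q, snd p \<oplus>\<^bsub>Y\<^esub> snd q)),
     smult = (\<lambda>c p. (c \<odot>\<^bsub>X\<^esub> fst p, c \<odot>\<^bsub>Y\<^esub> snd p)),
     hinner = (\<lambda>p q. hinner X (fst p) (fst q) + hinner Y (snd p) (snd q))\<rparr>"

definition linear_map :: "complex set \<Rightarrow> 'v hspace \<Rightarrow> 'w hspace \<Rightarrow> ('v \<Rightarrow> 'w) \<Rightarrow> bool" where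
  "linear_map K V W F \<longleftrightarrow>
     F \<in> carrier V \<rightarrow> carrier W \<and>
     (\<forall>x\<in>carrier V. \<forall>y\<in>carrier V. F (x \<oplus>\<^bsub>V\<^esub> y) = F x \<oplus>\<^bsub>W\<^esub> F y) \<and>
     (\<forall>c\<in>K. \<forall>x\<in>carrier V. F (c \<odot>\<^bsub>V\<^esub> x) = c \<odot>\<^bsub>W\<^esub> F x)"

definition bounded_operator :: "complex set \<Rightarrow> 'v hspace \<Rightarrow> 'w hspace \<Rightarrow> ('v \<Rightarrow> 'w) \<Rightarrow> bool" where
  "bounded_operator K V W F \<longleftrightarrow>
     linear_map K V W F \<and> (\<exists>C. \<forall>x\<in>carrier V. hnorm W (F x) \<le> C * hnorm V x)"


section \<open>Linear relations and range space relations\<close>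

text \<open>
  Domain, range, inverse and product of a relation are the library's \<open>Domain\<close>, \<open>Range\<close>,
  \<open>converse\<close> and \<open>(O)\<close>. Note the order of \<open>(O)\<close>: the product written $BA$
  (first $A$, then $B$) is \<open>A O B\<close>.
\<close>

definition linear_relation ::
    "complex set \<Rightarrow> 'x hspace \<Rightarrow> 'y hspace \<Rightarrow> ('x \<times> 'y) set \<Rightarrow> bool" where
  "linear_relation K X Y A \<longleftrightarrow> submodule A (scalar_field K) (hprod X Y)"

definition ker_rel :: "'y hspace \<Rightarrow> ('x \<times> 'y) set \<Rightarrow> 'x set" where
  "ker_rel Y A = {x. (x, \<zero>\<^bsub>Y\<^esub>) \<in> A}"

definition mul_rel :: "'x hspace \<Rightarrow> ('x \<times> 'y) set \<Rightarrow> 'y set" where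
  "mul_rel X A = {y. (\<zero>\<^bsub>X\<^esub>, y) \<in> A}"

definition operator_graph ::
    "complex set \<Rightarrow> 'x hspace \<Rightarrow> 'y hspace \<Rightarrow> ('x \<times> 'y) set \<Rightarrow> bool" where
  "operator_graph K X Y A \<longleftrightarrow>
     (\<exists>D T. submodule D (scalar_field K) X \<and> linear_map K (X\<lparr>carrier := D\<rparr>) Y T \<and>
            A = {(x, T x) | x. x \<in> D})"

text \<open>
  HOL cannot quantify over the type underlying \<open>W\<close>. Placing the carrier of \<open>W\<close> in the type
  \<open>'x \<times> 'y\<close> loses nothing: the lemma \<open>range_space_relationI\<close> below shows that a Hilbert
  space \<open>W\<close> over any type whatsoever yields a range space relation, since $W$ modulo the kernel of
  $F$ can be transported to the range of $F$.
\<close>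

definition range_space_relation ::
    "complex set \<Rightarrow> 'x hspace \<Rightarrow> 'y hspace \<Rightarrow> ('x \<times> 'y) set \<Rightarrow> bool" where
  "range_space_relation K X Y A \<longleftrightarrow>
     linear_relation K X Y A \<and>
     (\<exists>(W :: ('x \<times> 'y) hspace) F.
        hilbert_space K W \<and> bounded_operator K W (hprod X Y) F \<and> F ` carrier W = A)"

definition range_space_operator ::
    "complex set \<Rightarrow> 'x hspace \<Rightarrow> 'y hspace \<Rightarrow> ('x \<times> 'y) set \<Rightarrow> bool" where
  "range_space_operator K X Y A \<longleftrightarrow> range_space_relation K X Y A \<and> operator_graph K X Y A"


section \<open>Adequacy of the definitions\<close>

lemma scalar_field_simps [simp]:
  "carrier (scalar_field K) = K" "x \<otimes>\<^bsub>scalar_field K\<^esub> y = x * y"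
  "x \<oplus>\<^bsub>scalar_field K\<^esub> y = x + y" "\<one>\<^bsub>scalar_field K\<^esub> = 1" "\<zero>\<^bsub>scalar_field K\<^esub> = 0"
  by (simp_all add: scalar_field_def)

lemma hprod_simps [simp]:
  "carrier (hprod X Y) = carrier X \<times> carrier Y"
  "\<zero>\<^bsub>hprod X Y\<^esub> = (\<zero>\<^bsub>X\<^esub>, \<zero>\<^bsub>Y\<^esub>)"
  "p \<oplus>\<^bsub>hprod X Y\<^esub> q = (fst p \<oplus>\<^bsub>X\<^esub> fst q, snd p \<oplus>\<^bsub>Y\<^esub> snd q)"
  "c \<odot>\<^bsub>hprod X Y\<^esub> p = (c \<odot>\<^bsub>X\<^esub> fst p, c \<odot>\<^bsub>Y\<^esub> snd p)"
  "hinner (hprod X Y) p q = hinner X (fst p) (fst q) + hinner Y (snd p) (snd q)"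
  by (simp_all add: hprod_def)

context hilbert_space
begin

lemma K_closed:
  "of_real r \<in> K" "0 \<in> K" "1 \<in> K" "a \<in> K \<Longrightarrow> b \<in> K \<Longrightarrow> a * b \<in> K"
  "a \<in> K \<Longrightarrow> - a \<in> K" "a \<in> K \<Longrightarrow> a / of_real r \<in> K" "a \<in> K \<Longrightarrow> cnj a \<in> K"
  using scalars by (auto elim: Reals_cases)

lemma smult_in [simp]: "c \<in> K \<Longrightarrow> x \<in> carrier V \<Longrightarrow> c \<odot> x \<in> carrier V"
  using smult_closed by simp

lemma minus_add_cancel: "x \<in> carrier V \<Longrightarrow> y \<in> carrier V \<Longrightarrow> (x \<ominus> y) \<oplus> y = x"
  by (simp add: a_minus_def M.a_assoc M.l_neg)

lemma hinner_add_right: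
  "x \<in> carrier V \<Longrightarrow> y \<in> carrier V \<Longrightarrow> z \<in> carrier V \<Longrightarrow>
    hinner V z (x \<oplus> y) = hinner V z x + hinner V z y"
  using hinner_commute[of z "x \<oplus> y"] hinner_commute[of z x] hinner_commute[of z y]
  by (simp add: hinner_add_left)

lemma hinner_smult_right:
  "c \<in> K \<Longrightarrow> x \<in> carrier V \<Longrightarrow> y \<in> carrier V \<Longrightarrow> hinner V x (c \<odot> y) = cnj c * hinner V x y"
  using hinner_commute[of x "c \<odot> y"] hinner_commute[of x y] by (simp add: hinner_smult_left)

lemma hinner_minus_left:
  assumes "x \<in> carrier V" "y \<in> carrier V" "z \<in> carrier V"
  shows "hinner V (x \<ominus> y) z = hinner V x z - hinner V y z"
  using hinner_add_left[of "x \<ominus> y" y z] assms by (simp add: minus_add_cancel)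

lemma hinner_minus_right:
  assumes "x \<in> carrier V" "y \<in> carrier V" "z \<in> carrier V"
  shows "hinner V z (x \<ominus> y) = hinner V z x - hinner V z y"
  using hinner_add_right[of "x \<ominus> y" y z] assms by (simp add: minus_add_cancel)

lemma hinner_zero [simp]:
  assumes "x \<in> carrier V" shows "hinner V \<zero> x = 0" "hinner V x \<zero> = 0"
  using hinner_add_left[of \<zero> \<zero> x] hinner_add_right[of \<zero> \<zero> x] assms by simp_all

lemma hinner_self: "x \<in> carrier V \<Longrightarrow> hinner V x x = of_real (Re (hinner V x x))"
  using arg_cong[OF hinner_commute[of x x], of Im] by (simp add: complex_eq_iff)

lemma hinner_ge_0 [simp]: "x \<in> carrier V \<Longrightarrow> Re (hinner V x x) \<ge> 0"
  using hinner_pos[of x] by (cases "x = \<zero>") auto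

lemma hnorm_sq: "x \<in> carrier V \<Longrightarrow> (hnorm V x)\<^sup>2 = Re (hinner V x x)"
  by (simp add: hnorm_def)

lemma hnorm_ge_0 [simp]: "x \<in> carrier V \<Longrightarrow> hnorm V x \<ge> 0"
  by (simp add: hnorm_def)

lemma hnorm_eq_0: "x \<in> carrier V \<Longrightarrow> hnorm V x = 0 \<longleftrightarrow> x = \<zero>"
  using hinner_pos[of x] by (cases "x = \<zero>") (auto simp: hnorm_def)

lemma hnorm_add_smult_sq:
  assumes "x \<in> carrier V" "y \<in> carrier V" "y \<noteq> \<zero>"
  defines "c \<equiv> - hinner V x y / of_real (Re (hinner V y y))"
  shows "c \<in> K" "Re (hinner V (x \<oplus> c \<odot> y) (x \<oplus> c \<odot> y)) =
    Re (hinner V x x) - (cmod (hinner V x y))\<^sup>2 / Re (hinner V y y)"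
proof -
  show c: "c \<in> K" unfolding c_def by (intro K_closed hinner_in assms)
  let ?h = "hinner V x y" and ?s = "Re (hinner V y y)"
  have s: "?s > 0" using hinner_pos assms by simp
  have "hinner V (x \<oplus> c \<odot> y) (x \<oplus> c \<odot> y) =
     hinner V x x + cnj c * ?h + c * cnj ?h + c * cnj c * of_real ?s"
    using assms(1,2) c hinner_self[of y] hinner_commute[of y x]
    by (simp add: hinner_add_left hinner_add_right hinner_smult_left hinner_smult_right algebra_simps)
  also have "\<dots> = hinner V x x - ?h * cnj ?h / of_real ?s"
    using s by (simp add: c_def field_simps)
  also have "\<dots> = hinner V x x - of_real ((cmod ?h)\<^sup>2 / ?s)"
    by (simp add: complex_norm_square del: of_real_power)
  finally show "Re (hinner V (x \<oplus> c \<odot> y) (x \<oplus> c \<odot> y)) =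
    Re (hinner V x x) - (cmod ?h)\<^sup>2 / ?s" by simp
qed

lemma cauchy_schwarz:
  assumes "x \<in> carrier V" "y \<in> carrier V"
  shows "cmod (hinner V x y) \<le> hnorm V x * hnorm V y"
proof (cases "y = \<zero>")
  case True
  then show ?thesis using assms by simp
next
  case False
  have "0 \<le> Re (hinner V x x) - (cmod (hinner V x y))\<^sup>2 / Re (hinner V y y)"
    using hnorm_add_smult_sq[OF assms False] hinner_ge_0 assms by (metis M.a_closed smult_in)
  then have "(cmod (hinner V x y))\<^sup>2 \<le> (hnorm V x * hnorm V y)\<^sup>2"
    using hinner_pos[OF assms(2) False] assms by (simp add: field_simps power_mult_distrib hnorm_sq)
  then show ?thesis by (rule power2_le_imp_le) (use assms in simp)
qed

lemma hnorm_triangle: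
  assumes "x \<in> carrier V" "y \<in> carrier V"
  shows "hnorm V (x \<oplus> y) \<le> hnorm V x + hnorm V y"
proof -
  have "(hnorm V (x \<oplus> y))\<^sup>2 = Re (hinner V x x) + 2 * Re (hinner V x y) + Re (hinner V y y)"
    using assms hinner_commute[of y x] by (simp add: hnorm_sq hinner_add_left hinner_add_right)
  also have "\<dots> \<le> (hnorm V x + hnorm V y)\<^sup>2"
    using cauchy_schwarz[OF assms] complex_Re_le_cmod[of "hinner V x y"] assms
    by (simp add: power2_sum hnorm_sq)
  finally show ?thesis by (rule power2_le_imp_le) (use assms in simp)
qed

lemma hnorm_minus_commute:
  assumes "x \<in> carrier V" "y \<in> carrier V"
  shows "hnorm V (x \<ominus> y) = hnorm V (y \<ominus> x)"
  using assms by (simp add: hnorm_def hinner_minus_left hinner_minus_right)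

lemma parallelogram:
  assumes "x \<in> carrier V" "y \<in> carrier V"
  shows "(hnorm V (x \<ominus> y))\<^sup>2 = 2 * (hnorm V x)\<^sup>2 + 2 * (hnorm V y)\<^sup>2 - 4 * (hnorm V ((1/2) \<odot> (x \<oplus> y)))\<^sup>2"
proof -
  have "(1/2 :: complex) \<in> K" using K_closed(1)[of "1/2"] by simp
  then show ?thesis using assms
    by (simp add: hnorm_sq hinner_add_left hinner_add_right hinner_minus_left hinner_minus_right
      hinner_smult_left hinner_smult_right field_simps)
qed

lemma minus_a_assoc:
  assumes "x \<in> carrier V" "y \<in> carrier V" "z \<in> carrier V"
  shows "(x \<ominus> y) \<oplus> (y \<ominus> z) = x \<ominus> z"
  using assms by (simp add: a_minus_def M.a_assoc M.l_neg M.r_neg1 M.r_neg2)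

end

lemma hprod_hilbert_space:
  assumes "hilbert_space K X" "hilbert_space K Y"
  shows "hilbert_space K (hprod X Y)"
proof -
  interpret X: hilbert_space K X by fact
  interpret Y: hilbert_space K Y by fact
  have grp: "abelian_group (hprod X Y)"
  proof (rule abelian_groupI)
    fix p assume "p \<in> carrier (hprod X Y)"
    then show "\<exists>q\<in>carrier (hprod X Y). q \<oplus>\<^bsub>hprod X Y\<^esub> p = \<zero>\<^bsub>hprod X Y\<^esub>"
      by (intro bexI[of _ "(\<ominus>\<^bsub>X\<^esub> fst p, \<ominus>\<^bsub>Y\<^esub> snd p)"]) (auto simp: X.M.l_neg Y.M.l_neg)
  qed (auto simp: X.M.a_ac Y.M.a_ac)
  interpret P: abelian_group "hprod X Y" by (fact grp)
  have minus: "p \<ominus>\<^bsub>hprod X Y\<^esub> q = (fst p \<ominus>\<^bsub>X\<^esub> fst q, snd p \<ominus>\<^bsub>Y\<^esub> snd q)"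
    if "p \<in> carrier (hprod X Y)" "q \<in> carrier (hprod X Y)" for p q
  proof -
    have "\<ominus>\<^bsub>hprod X Y\<^esub> q = (\<ominus>\<^bsub>X\<^esub> fst q, \<ominus>\<^bsub>Y\<^esub> snd q)"
      by (rule P.minus_equality) (use that in \<open>auto simp: X.M.l_neg Y.M.l_neg\<close>)
    then show ?thesis by (simp add: a_minus_def)
  qed
  have mod: "module (scalar_field K) (hprod X Y)"
    by (rule moduleI[OF X.R.is_cring grp])
      (use X.smult_l_distr Y.smult_l_distr X.smult_r_distr Y.smult_r_distr
        X.smult_assoc1 Y.smult_assoc1 X.smult_one Y.smult_one in auto)
  show ?thesis
  proof (intro hilbert_space.intro[OF mod] hilbert_space_axioms.intro)
    show "K = \<real> \<or> K = UNIV" by (fact X.scalars)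
  next
    fix p q assume "p \<in> carrier (hprod X Y)" "q \<in> carrier (hprod X Y)"
    then show "hinner (hprod X Y) p q \<in> K" "hinner (hprod X Y) p q = cnj (hinner (hprod X Y) q p)"
      using X.R.a_closed[of "hinner X (fst p) (fst q)" "hinner Y (snd p) (snd q)"]
        X.hinner_in Y.hinner_in X.hinner_commute[of "fst p" "fst q"] Y.hinner_commute[of "snd p" "snd q"]
      by auto
  next
    fix p assume "p \<in> carrier (hprod X Y)" "p \<noteq> \<zero>\<^bsub>hprod X Y\<^esub>"
    then show "0 < Re (hinner (hprod X Y) p p)"
      using X.hinner_pos[of "fst p"] Y.hinner_pos[of "snd p"] X.hinner_ge_0[of "fst p"] Y.hinner_ge_0[of "snd p"]
      by (cases "fst p = \<zero>\<^bsub>X\<^esub>") (auto simp: prod_eq_iff mem_Times_iff intro: add_pos_nonneg)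
  next
    fix s :: "nat \<Rightarrow> 'a \<times> 'b"
    assume s: "\<And>n. s n \<in> carrier (hprod X Y)"
      and C: "\<And>e. e > 0 \<Longrightarrow> \<exists>N. \<forall>m\<ge>N. \<forall>n\<ge>N. hnorm (hprod X Y) (s m \<ominus>\<^bsub>hprod X Y\<^esub> s n) < e"
    have s12: "fst (s n) \<in> carrier X" "snd (s n) \<in> carrier Y" for n using s[of n] by auto
    have nrm: "hnorm (hprod X Y) p = sqrt ((hnorm X (fst p))\<^sup>2 + (hnorm Y (snd p))\<^sup>2)"
      if "p \<in> carrier (hprod X Y)" for p
      using that by (auto simp: hnorm_def)
    have "hnorm X (fst p) \<le> hnorm (hprod X Y) p" "hnorm Y (snd p) \<le> hnorm (hprod X Y) p"
      if "p \<in> carrier (hprod X Y)" for p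
      using that by (auto simp: nrm)
    then have le: "hnorm X (fst (s m) \<ominus>\<^bsub>X\<^esub> fst (s n)) \<le> hnorm (hprod X Y) (s m \<ominus>\<^bsub>hprod X Y\<^esub> s n)"
        "hnorm Y (snd (s m) \<ominus>\<^bsub>Y\<^esub> snd (s n)) \<le> hnorm (hprod X Y) (s m \<ominus>\<^bsub>hprod X Y\<^esub> s n)" for m n
      using minus[OF s s] P.minus_closed[OF s s] by (metis fst_conv, metis snd_conv)
    obtain a where a: "a \<in> carrier X" "(\<lambda>n. hnorm X (fst (s n) \<ominus>\<^bsub>X\<^esub> a)) \<longlonglongrightarrow> 0"
      using X.complete[of "\<lambda>n. fst (s n)"] s12 C le(1) by (meson le_less_trans)
    obtain b where b: "b \<in> carrier Y" "(\<lambda>n. hnorm Y (snd (s n) \<ominus>\<^bsub>Y\<^esub> b)) \<longlonglongrightarrow> 0"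
      using Y.complete[of "\<lambda>n. snd (s n)"] s12 C le(2) by (meson le_less_trans)
    have ab: "(a, b) \<in> carrier (hprod X Y)" using a b by simp
    have "(\<lambda>n. sqrt ((hnorm X (fst (s n) \<ominus>\<^bsub>X\<^esub> a))\<^sup>2 + (hnorm Y (snd (s n) \<ominus>\<^bsub>Y\<^esub> b))\<^sup>2)) \<longlonglongrightarrow> sqrt (0\<^sup>2 + 0\<^sup>2)"
      by (intro tendsto_intros a b)
    then have "(\<lambda>n. hnorm (hprod X Y) (s n \<ominus>\<^bsub>hprod X Y\<^esub> (a, b))) \<longlonglongrightarrow> 0"
      using nrm[OF P.minus_closed[OF s ab]] by (simp add: minus[OF s ab])
    then show "\<exists>l\<in>carrier (hprod X Y). (\<lambda>n. hnorm (hprod X Y) (s n \<ominus>\<^bsub>hprod X Y\<^esub> l)) \<longlonglongrightarrow> 0"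
      using ab by blast
  qed (auto simp: X.hinner_add_left Y.hinner_add_left X.hinner_smult_left Y.hinner_smult_left algebra_simps)
qed


lemma linear_mapD:
  assumes "linear_map K W P F"
  shows "x \<in> carrier W \<Longrightarrow> F x \<in> carrier P"
    and "x \<in> carrier W \<Longrightarrow> y \<in> carrier W \<Longrightarrow> F (x \<oplus>\<^bsub>W\<^esub> y) = F x \<oplus>\<^bsub>P\<^esub> F y"
    and "c \<in> K \<Longrightarrow> x \<in> carrier W \<Longrightarrow> F (c \<odot>\<^bsub>W\<^esub> x) = c \<odot>\<^bsub>P\<^esub> F x"
  using assms by (auto simp: linear_map_def)

lemma linear_map_minus:
  assumes "hilbert_space K W" "hilbert_space K P" "linear_map K W P F"
    and "x \<in> carrier W" "y \<in> carrier W"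
  shows "F (x \<ominus>\<^bsub>W\<^esub> y) = F x \<ominus>\<^bsub>P\<^esub> F y"
proof -
  interpret W: hilbert_space K W by fact
  interpret P: hilbert_space K P by fact
  note F = linear_mapD[OF assms(3)]
  have "F x = F (x \<ominus>\<^bsub>W\<^esub> y) \<oplus>\<^bsub>P\<^esub> F y"
    using F(2)[of "x \<ominus>\<^bsub>W\<^esub> y" y] assms(4,5) by (simp add: W.minus_add_cancel)
  then show ?thesis
    using assms(4,5) by (simp add: F(1) a_minus_def P.M.a_assoc P.M.r_neg)
qed

lemma linear_map_image_submodule:
  assumes "hilbert_space K W" "hilbert_space K P" "linear_map K W P F"
  shows "submodule (F ` carrier W) (scalar_field K) P"
proof -
  interpret W: hilbert_space K W by fact
  interpret P: hilbert_space K P by fact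
  note F = linear_mapD[OF assms(3)]
  have neg: "\<ominus>\<^bsub>P\<^esub> p = (-1) \<odot>\<^bsub>P\<^esub> p" if "p \<in> carrier P" for p
  proof (rule P.M.minus_equality)
    have m: "(-1::complex) \<in> K" using P.K_closed by blast
    have "(-1) \<odot>\<^bsub>P\<^esub> p \<oplus>\<^bsub>P\<^esub> 1 \<odot>\<^bsub>P\<^esub> p = \<zero>\<^bsub>P\<^esub>"
      using P.smult_l_distr[of "-1" 1 p] P.K_closed(3) P.smult_l_null[OF that] that m by simp
    then show "(-1) \<odot>\<^bsub>P\<^esub> p \<oplus>\<^bsub>P\<^esub> p = \<zero>\<^bsub>P\<^esub>" using P.smult_one[OF that] by simp
    show "(-1) \<odot>\<^bsub>P\<^esub> p \<in> carrier P" using m that by simp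
  qed (fact that)
  have sm: "c \<odot>\<^bsub>P\<^esub> p \<in> F ` carrier W" if "c \<in> K" "p \<in> F ` carrier W" for c p
    using that by (auto simp: F(3)[symmetric])
  show ?thesis
  proof (rule P.submoduleI)
    show "F ` carrier W \<subseteq> carrier P" using F(1) by auto
    show "\<zero>\<^bsub>P\<^esub> \<in> F ` carrier W"
      using sm[of 0 "F \<zero>\<^bsub>W\<^esub>"] P.K_closed(2) P.smult_l_null[of "F \<zero>\<^bsub>W\<^esub>"] F(1) by auto
    show "\<ominus>\<^bsub>P\<^esub> p \<in> F ` carrier W" if "p \<in> F ` carrier W" for p
      using that F(1) neg[of p] sm[of "-1" p] P.K_closed(3,5) by auto
    show "p \<oplus>\<^bsub>P\<^esub> q \<in> F ` carrier W" if "p \<in> F ` carrier W" "q \<in> F ` carrier W" for p q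
      using that by (auto simp: F(2)[symmetric])
  qed (simp add: sm)
qed

text \<open>The element of minimal norm in a fibre of \<open>F\<close> is orthogonal to the kernel.\<close>

lemma minimal_preimage:
  assumes "hilbert_space K W" "hilbert_space K P" "bounded_operator K W P F" "a \<in> F ` carrier W"
  shows "\<exists>w\<in>carrier W. F w = a \<and> (\<forall>k\<in>carrier W. F k = \<zero>\<^bsub>P\<^esub> \<longrightarrow> hinner W w k = 0)"
proof -
  interpret W: hilbert_space K W by fact
  interpret P: hilbert_space K P by fact
  from assms(3) obtain C where lin: "linear_map K W P F"
    and C: "\<And>x. x \<in> carrier W \<Longrightarrow> hnorm P (F x) \<le> C * hnorm W x"
    unfolding bounded_operator_def by blast
  note F = linear_mapD[OF lin] and Fin = linear_mapD(1)[OF lin]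
  note Fminus = linear_map_minus[OF assms(1,2) lin]
  define S where "S = {w \<in> carrier W. F w = a}"
  have S: "w \<in> carrier W" "F w = a" if "w \<in> S" for w using that by (auto simp: S_def)
  have a: "a \<in> carrier P" using assms(4) Fin by auto
  define d where "d = (INF w\<in>S. (hnorm W w)\<^sup>2)"
  have bdd: "bdd_below ((\<lambda>w. (hnorm W w)\<^sup>2) ` S)" by (intro bdd_belowI[of _ 0]) auto
  have ne: "S \<noteq> {}" using assms(4) by (auto simp: S_def)
  have d_le: "d \<le> (hnorm W w)\<^sup>2" if "w \<in> S" for w
    unfolding d_def using bdd that by (rule cINF_lower)
  have "\<exists>w\<in>S. (hnorm W w)\<^sup>2 < d + inverse (real (Suc n))" for n
    using cINF_less_iff[OF ne bdd, of "d + inverse (real (Suc n))"] by (simp add: d_def)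
  then obtain s where s: "\<And>n. s n \<in> S" "\<And>n. (hnorm W (s n))\<^sup>2 < d + inverse (real (Suc n))"
    by metis
  have sW: "s n \<in> carrier W" for n using S s by blast
  have half: "(1/2 :: complex) \<in> K" using W.K_closed(1)[of "1/2"] by simp
  have mid: "(1/2) \<odot>\<^bsub>W\<^esub> (x \<oplus>\<^bsub>W\<^esub> y) \<in> S" if "x \<in> S" "y \<in> S" for x y
  proof -
    have "(1/2) \<odot>\<^bsub>P\<^esub> (a \<oplus>\<^bsub>P\<^esub> a) = (1/2 + 1/2) \<odot>\<^bsub>P\<^esub> a"
      using P.smult_l_distr[of "1/2" "1/2" a] P.smult_r_distr[of "1/2" a a] a half by simp
    also have "\<dots> = a" using P.smult_one[OF a] by simp
    finally show ?thesis using S[OF that(1)] S[OF that(2)] half F by (simp add: S_def)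
  qed
  have diff: "(hnorm W (s m \<ominus>\<^bsub>W\<^esub> s n))\<^sup>2 \<le> 2 * inverse (real (Suc m)) + 2 * inverse (real (Suc n))" for m n
    using W.parallelogram[OF sW sW, of m n] d_le[OF mid[OF s(1) s(1)], of m n] s(2)[of m] s(2)[of n]
    by linarith
  have "\<exists>N. \<forall>m\<ge>N. \<forall>n\<ge>N. hnorm W (s m \<ominus>\<^bsub>W\<^esub> s n) < e" if "e > 0" for e
  proof -
    obtain N where N: "inverse (real (Suc N)) < e\<^sup>2 / 4"
      using reals_Archimedean[OF divide_pos_pos[OF zero_less_power[OF \<open>e > 0\<close>] zero_less_numeral]] by blast
    have "hnorm W (s m \<ominus>\<^bsub>W\<^esub> s n) < e" if "m \<ge> N" "n \<ge> N" for m n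
    proof -
      have "inverse (real (Suc m)) \<le> inverse (real (Suc N))" "inverse (real (Suc n)) \<le> inverse (real (Suc N))"
        using that by (auto intro!: le_imp_inverse_le)
      then have "(hnorm W (s m \<ominus>\<^bsub>W\<^esub> s n))\<^sup>2 < e\<^sup>2" using diff[of m n] N by linarith
      then show ?thesis using \<open>e > 0\<close> by (simp add: power_less_imp_less_base)
    qed
    then show ?thesis by blast
  qed
  then obtain l where l: "l \<in> carrier W" and lim: "(\<lambda>n. hnorm W (s n \<ominus>\<^bsub>W\<^esub> l)) \<longlonglongrightarrow> 0"
    using W.complete[of s] sW by blast
  have Fl: "F l = a"
  proof -
    have "hnorm P (a \<ominus>\<^bsub>P\<^esub> F l) \<le> C * hnorm W (s n \<ominus>\<^bsub>W\<^esub> l)" for n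
      using C[of "s n \<ominus>\<^bsub>W\<^esub> l"] Fminus[OF sW l, of n] S[OF s(1)] sW l by simp
    moreover have "(\<lambda>n. C * hnorm W (s n \<ominus>\<^bsub>W\<^esub> l)) \<longlonglongrightarrow> 0"
      using tendsto_mult_right_zero[OF lim] .
    ultimately have "hnorm P (a \<ominus>\<^bsub>P\<^esub> F l) \<le> 0"
      by (intro LIMSEQ_le_const) auto
    then have "a \<ominus>\<^bsub>P\<^esub> F l = \<zero>\<^bsub>P\<^esub>"
      using P.hnorm_eq_0 P.hnorm_ge_0 a Fin[OF l] by (metis P.M.minus_closed order_antisym)
    then show ?thesis using P.minus_add_cancel[OF a Fin[OF l]] Fin[OF l] by simp
  qed
  have ld: "(hnorm W l)\<^sup>2 \<le> d"
  proof -
    have "hnorm W l \<le> hnorm W (s n \<ominus>\<^bsub>W\<^esub> l) + sqrt (d + inverse (real (Suc n)))" for n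
    proof -
      have "hnorm W l \<le> hnorm W (l \<ominus>\<^bsub>W\<^esub> s n) + hnorm W (s n)"
        using W.hnorm_triangle[of "l \<ominus>\<^bsub>W\<^esub> s n" "s n"] sW l by (simp add: W.minus_add_cancel)
      moreover have "hnorm W (s n) \<le> sqrt (d + inverse (real (Suc n)))"
        using s(2)[of n] by (intro real_le_rsqrt) simp
      ultimately show ?thesis using W.hnorm_minus_commute[OF sW l] by simp
    qed
    moreover have "(\<lambda>n. hnorm W (s n \<ominus>\<^bsub>W\<^esub> l) + sqrt (d + inverse (real (Suc n)))) \<longlonglongrightarrow> 0 + sqrt (d + 0)"
      by (intro tendsto_intros lim LIMSEQ_inverse_real_of_nat)
    ultimately have "hnorm W l \<le> sqrt d" by (intro LIMSEQ_le_const) auto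
    moreover have "d \<ge> 0" unfolding d_def by (intro cINF_greatest ne) simp
    ultimately show ?thesis using W.hnorm_ge_0[OF l] by (metis power_mono real_sqrt_pow2)
  qed
  have "hinner W l k = 0" if k: "k \<in> carrier W" "F k = \<zero>\<^bsub>P\<^esub>" for k
  proof (cases "k = \<zero>\<^bsub>W\<^esub>")
    case False
    let ?c = "- hinner W l k / of_real (Re (hinner W k k))"
    note c = W.hnorm_add_smult_sq[OF l k(1) False]
    have "l \<oplus>\<^bsub>W\<^esub> ?c \<odot>\<^bsub>W\<^esub> k \<in> S"
      using l k c(1) a Fl F P.smult_r_null[of ?c] by (simp add: S_def del: of_real_Re)
    then have "d \<le> Re (hinner W l l) - (cmod (hinner W l k))\<^sup>2 / Re (hinner W k k)"
      using d_le c(2) S(1) W.hnorm_sq by metis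
    then have "(cmod (hinner W l k))\<^sup>2 / Re (hinner W k k) \<le> 0"
      using ld W.hnorm_sq[OF l] by simp
    then show ?thesis using W.hinner_pos[OF k(1) False] by (simp add: divide_le_0_iff)
  qed (use l in simp)
  then show ?thesis using l Fl by blast
qed

lemma hilbert_space_transport:
  fixes W :: "'w hspace" and P :: "'p hspace"
  assumes "hilbert_space K W" "hilbert_space K P" "bounded_operator K W P F"
  shows "\<exists>V :: 'p hspace. hilbert_space K V \<and> carrier V = F ` carrier W \<and> bounded_operator K V P (\<lambda>x. x)"
proof -
  interpret W: hilbert_space K W by fact
  interpret P: hilbert_space K P by fact
  from assms(3) obtain C where lin: "linear_map K W P F"
    and C: "\<And>x. x \<in> carrier W \<Longrightarrow> hnorm P (F x) \<le> C * hnorm W x"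
    unfolding bounded_operator_def by blast
  note F = linear_mapD[OF lin] and Fin = linear_mapD(1)[OF lin]
  note Fminus = linear_map_minus[OF assms(1,2) lin]
  define R where "R = {w \<in> carrier W. \<forall>k\<in>carrier W. F k = \<zero>\<^bsub>P\<^esub> \<longrightarrow> hinner W w k = 0}"
  have Rc: "w \<in> carrier W" if "w \<in> R" for w using that by (simp add: R_def)
  have Radd: "x \<oplus>\<^bsub>W\<^esub> y \<in> R" "x \<ominus>\<^bsub>W\<^esub> y \<in> R" if "x \<in> R" "y \<in> R" for x y
    using that by (auto simp: R_def W.hinner_add_left W.hinner_minus_left)
  have Rsm: "c \<odot>\<^bsub>W\<^esub> x \<in> R" if "c \<in> K" "x \<in> R" for c x
    using that by (auto simp: R_def W.hinner_smult_left)
  have inj: "x = y" if "x \<in> R" "y \<in> R" "F x = F y" for x y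
  proof -
    have "F (x \<ominus>\<^bsub>W\<^esub> y) = \<zero>\<^bsub>P\<^esub>"
      using Fminus[of x y] that by (simp add: Rc Fin a_minus_def P.M.r_neg)
    then have "hinner W (x \<ominus>\<^bsub>W\<^esub> y) (x \<ominus>\<^bsub>W\<^esub> y) = 0"
      using Radd(2)[OF that(1,2)] by (simp add: R_def)
    then have "x \<ominus>\<^bsub>W\<^esub> y = \<zero>\<^bsub>W\<^esub>"
      using W.hinner_pos[of "x \<ominus>\<^bsub>W\<^esub> y"] that Rc by fastforce
    then show ?thesis using W.minus_add_cancel[of x y] that Rc by simp
  qed
  define A where "A = F ` carrier W"
  have "\<exists>w\<in>R. F w = a" if "a \<in> A" for a
    using minimal_preimage[OF assms, of a] that by (auto simp: A_def R_def)
  then obtain m where m: "\<And>a. a \<in> A \<Longrightarrow> m a \<in> R" "\<And>a. a \<in> A \<Longrightarrow> F (m a) = a" by metis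
  note mW = Rc[OF m(1)]
  have mF: "m (F w) = w" if "w \<in> R" for w
    using inj m that Rc by (simp add: A_def)
  have sub: "submodule A (scalar_field K) P"
    unfolding A_def using linear_map_image_submodule[OF assms(1,2)] assms(3)
    by (simp add: bounded_operator_def)
  note subE = P.submoduleE[OF sub, simplified]
  have AP: "a \<in> carrier P" if "a \<in> A" for a using subE(1) that by blast
  have m_add: "m (a \<oplus>\<^bsub>P\<^esub> b) = m a \<oplus>\<^bsub>W\<^esub> m b" if "a \<in> A" "b \<in> A" for a b
    using mF[OF Radd(1)[OF m(1) m(1)], of a b] that by (simp add: F mW m)
  have m_minus: "m (a \<ominus>\<^bsub>P\<^esub> b) = m a \<ominus>\<^bsub>W\<^esub> m b" if "a \<in> A" "b \<in> A" for a b
    using mF[OF Radd(2)[OF m(1) m(1)], of a b] that by (simp add: Fminus mW m)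
  have m_sm: "m (c \<odot>\<^bsub>P\<^esub> a) = c \<odot>\<^bsub>W\<^esub> m a" if "c \<in> K" "a \<in> A" for a c
    using mF[OF Rsm[OF _ m(1)], of c a] that by (simp add: F mW m)
  define V where "V = P\<lparr>carrier := A, hinner := \<lambda>a b. hinner W (m a) (m b)\<rparr>"
  have V_simps [simp]: "carrier V = A" "zero V = zero P" "add V = add P" "smult V = smult P"
      "hinner V a b = hinner W (m a) (m b)" for a b
    by (simp_all add: V_def)
  have nV: "hnorm V a = hnorm W (m a)" for a by (simp add: hnorm_def)
  have mod: "module (scalar_field K) V"
  proof -
    have "module (scalar_field K) (P\<lparr>carrier := A\<rparr>)"
      using submodule.submodule_is_module[OF sub] P.module_axioms by blast
    moreover have "add_monoid V = add_monoid (P\<lparr>carrier := A\<rparr>)" by simp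
    ultimately show ?thesis
      unfolding module_def abelian_group_def abelian_group_axioms_def abelian_monoid_def module_axioms_def
      by simp
  qed
  interpret V: module "scalar_field K" V by (fact mod)
  have minusV: "a \<ominus>\<^bsub>V\<^esub> b = a \<ominus>\<^bsub>P\<^esub> b" if "a \<in> A" "b \<in> A" for a b
  proof -
    have "\<ominus>\<^bsub>V\<^esub> b = \<ominus>\<^bsub>P\<^esub> b"
      by (rule V.minus_equality) (use that subE AP in \<open>auto simp: P.M.l_neg\<close>)
    then show ?thesis by (simp add: a_minus_def)
  qed
  have minusA: "a \<ominus>\<^bsub>P\<^esub> b \<in> A" if "a \<in> A" "b \<in> A" for a b
    using that subE by (simp add: a_minus_def)
  have m0: "a = \<zero>\<^bsub>P\<^esub>" if "a \<in> A" "m a = \<zero>\<^bsub>W\<^esub>" for a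
    using m(2)[OF that(1)] that Fminus[of "\<zero>\<^bsub>W\<^esub>" "\<zero>\<^bsub>W\<^esub>"] Fin[of "\<zero>\<^bsub>W\<^esub>"]
    by (simp add: a_minus_def W.M.r_neg P.M.r_neg)
  have "hilbert_space K V"
  proof (intro hilbert_space.intro[OF mod] hilbert_space_axioms.intro)
    show "K = \<real> \<or> K = UNIV" by (fact W.scalars)
  next
    fix a b assume "a \<in> carrier V" "b \<in> carrier V"
    then show "hinner V a b = cnj (hinner V b a)" unfolding V_simps by (intro W.hinner_commute mW)
  next
    fix a assume "a \<in> carrier V" "a \<noteq> \<zero>\<^bsub>V\<^esub>"
    then show "0 < Re (hinner V a a)" using W.hinner_pos[of "m a"] mW m0 by auto
  next
    fix s :: "nat \<Rightarrow> 'p" assume s: "\<And>n. s n \<in> carrier V"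
      and Cauchy: "\<And>e. e > 0 \<Longrightarrow> \<exists>N. \<forall>i\<ge>N. \<forall>j\<ge>N. hnorm V (s i \<ominus>\<^bsub>V\<^esub> s j) < e"
    have sA: "s n \<in> A" for n using s by simp
    have "\<exists>l\<in>carrier W. (\<lambda>n. hnorm W (m (s n) \<ominus>\<^bsub>W\<^esub> l)) \<longlonglongrightarrow> 0"
      using Cauchy sA by (intro W.complete) (simp_all add: mW minusV nV m_minus)
    then obtain l where l: "l \<in> carrier W" and lim: "(\<lambda>n. hnorm W (m (s n) \<ominus>\<^bsub>W\<^esub> l)) \<longlonglongrightarrow> 0" by blast
    have "hinner W l k = 0" if k: "k \<in> carrier W" "F k = \<zero>\<^bsub>P\<^esub>" for k
    proof -
      have "cmod (hinner W l k) \<le> hnorm W (m (s n) \<ominus>\<^bsub>W\<^esub> l) * hnorm W k" for n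
      proof -
        have "hinner W (m (s n) \<ominus>\<^bsub>W\<^esub> l) k = - hinner W l k"
          using m(1)[OF sA] k l by (simp add: W.hinner_minus_left R_def)
        then show ?thesis
          using W.cauchy_schwarz[of "m (s n) \<ominus>\<^bsub>W\<^esub> l" k] k l mW[OF sA] by simp
      qed
      moreover have "(\<lambda>n. hnorm W (m (s n) \<ominus>\<^bsub>W\<^esub> l) * hnorm W k) \<longlonglongrightarrow> 0"
        using tendsto_mult_left_zero[OF lim] .
      ultimately have "cmod (hinner W l k) \<le> 0" by (intro LIMSEQ_le_const) auto
      then show ?thesis by simp
    qed
    then have "l \<in> R" using l by (simp add: R_def)
    then have "F l \<in> A" "m (F l) = l" using mF l by (auto simp: A_def)
    then show "\<exists>l\<in>carrier V. (\<lambda>n. hnorm V (s n \<ominus>\<^bsub>V\<^esub> l)) \<longlonglongrightarrow> 0"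
      using lim by (intro bexI[of _ "F l"]) (simp_all add: minusV nV m_minus sA)
  qed (simp_all add: m_add m_sm mW W.hinner_in W.hinner_add_left W.hinner_smult_left)
  moreover have "bounded_operator K V P (\<lambda>x. x)"
    unfolding bounded_operator_def linear_map_def
    using AP C[OF mW] m(2) by (auto simp: nV intro!: exI[of _ C])
  ultimately show ?thesis using V_simps(1) A_def by blast
qed

lemma range_space_relationI:
  fixes W :: "'w hspace"
  assumes "hilbert_space K X" "hilbert_space K Y" "hilbert_space K W"
    and "bounded_operator K W (hprod X Y) F"
  shows "range_space_relation K X Y (F ` carrier W)"
proof -
  note XY = hprod_hilbert_space[OF assms(1,2)]
  have "linear_relation K X Y (F ` carrier W)"
    using linear_map_image_submodule[OF assms(3) XY] assms(4)
    by (simp add: linear_relation_def bounded_operator_def)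
  moreover obtain V where "hilbert_space K V" "carrier V = F ` carrier W"
      "bounded_operator K V (hprod X Y) (\<lambda>x. x)"
    using hilbert_space_transport[OF assms(3) XY assms(4)] by blast
  ultimately show ?thesis unfolding range_space_relation_def by (metis image_ident)
qed

lemma operator_graph_iff:
  assumes "hilbert_space K X" "hilbert_space K Y" "linear_relation K X Y A"
  shows "operator_graph K X Y A \<longleftrightarrow> mul_rel X A = {\<zero>\<^bsub>Y\<^esub>}"
proof -
  interpret X: hilbert_space K X by fact
  interpret Y: hilbert_space K Y by fact
  interpret P: hilbert_space K "hprod X Y" by (rule hprod_hilbert_space) fact+
  note E = P.submoduleE[OF assms(3)[unfolded linear_relation_def], simplified]
  have in_carrier: "x \<in> carrier X" "y \<in> carrier Y" if "(x, y) \<in> A" for x y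
    using that E(1) by auto
  have sm: "(c \<odot>\<^bsub>X\<^esub> x, c \<odot>\<^bsub>Y\<^esub> y) \<in> A" if "c \<in> K" "(x, y) \<in> A" for c x y
    using E(4)[OF that] by simp
  have add: "(x \<oplus>\<^bsub>X\<^esub> x', y \<oplus>\<^bsub>Y\<^esub> y') \<in> A" if "(x, y) \<in> A" "(x', y') \<in> A" for x y x' y'
    using E(5)[OF that] by simp
  have neg: "(\<ominus>\<^bsub>X\<^esub> x, \<ominus>\<^bsub>Y\<^esub> y) \<in> A" if "(x, y) \<in> A" for x y
  proof -
    have "\<ominus>\<^bsub>hprod X Y\<^esub> (x, y) = (\<ominus>\<^bsub>X\<^esub> x, \<ominus>\<^bsub>Y\<^esub> y)"
      by (rule P.M.minus_equality) (use in_carrier[OF that] in \<open>auto simp: X.M.l_neg Y.M.l_neg\<close>)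
    then show ?thesis using E(3)[OF that] by simp
  qed
  obtain a b where "(a, b) \<in> A" using E(2) by auto
  then have zero: "(\<zero>\<^bsub>X\<^esub>, \<zero>\<^bsub>Y\<^esub>) \<in> A"
    using add[OF _ neg] in_carrier by (metis X.M.r_neg Y.M.r_neg)
  show ?thesis
  proof
    assume "operator_graph K X Y A"
    then obtain D T where D: "submodule D (scalar_field K) X"
      and T: "linear_map K (X\<lparr>carrier := D\<rparr>) Y T" and A: "A = {(x, T x) | x. x \<in> D}"
      unfolding operator_graph_def by blast
    have "mul_rel X A = {T \<zero>\<^bsub>X\<^esub>}" using zero by (auto simp: mul_rel_def A)
    moreover have "T \<zero>\<^bsub>X\<^esub> = \<zero>\<^bsub>Y\<^esub>" using zero by (auto simp: A)
    ultimately show "mul_rel X A = {\<zero>\<^bsub>Y\<^esub>}" by simp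
  next
    assume mul: "mul_rel X A = {\<zero>\<^bsub>Y\<^esub>}"
    have uniq: "y = y'" if "(x, y) \<in> A" "(x, y') \<in> A" for x y y'
    proof -
      have "(\<zero>\<^bsub>X\<^esub>, y \<ominus>\<^bsub>Y\<^esub> y') \<in> A"
        using add[OF that(1) neg[OF that(2)]] in_carrier[OF that(1)] by (simp add: X.M.r_neg a_minus_def)
      then have "y \<ominus>\<^bsub>Y\<^esub> y' = \<zero>\<^bsub>Y\<^esub>" using mul by (auto simp: mul_rel_def)
      then show ?thesis
        using Y.minus_add_cancel[of y y'] in_carrier that by simp
    qed
    define T where "T x = (THE y. (x, y) \<in> A)" for x
    have T: "T x = y" if "(x, y) \<in> A" for x y
      unfolding T_def using that uniq by blast
    have "submodule (Domain A) (scalar_field K) X"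
      by (rule X.submoduleI) (use in_carrier zero in \<open>auto intro: DomainI[OF neg] DomainI[OF add] DomainI[OF sm]\<close>)
    moreover have "linear_map K (X\<lparr>carrier := Domain A\<rparr>) Y T"
      unfolding linear_map_def using in_carrier by (auto simp: T dest: T[OF add] T[OF sm])
    moreover have "A = {(x, T x) | x. x \<in> Domain A}" using T by auto
    ultimately show "operator_graph K X Y A" unfolding operator_graph_def by blast
  qed
qed

end

theory Submission
  imports Defs
begin

text \<open>
  Write \<open>A\<close> and \<open>B\<close> as ranges of bounded operators \<open>F\<close> on \<open>V\<close> and \<open>G\<close> on \<open>W\<close>. Then $B^{-1}A$ is
  the range of $(u, v) \mapsto (F_1 u, G_1 v)$ on the closed subspace of $V \times W$ where
  $F_2 u = G_2 v$, so it is always a range space relation. The rest is algebra of linear relations.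
\<close>

section \<open>Bounded operators: composition, projections, pairing, restriction\<close>

lemma linear_mapI:
  assumes "\<And>x. x \<in> carrier V \<Longrightarrow> F x \<in> carrier W"
    and "\<And>x y. x \<in> carrier V \<Longrightarrow> y \<in> carrier V \<Longrightarrow> F (x \<oplus>\<^bsub>V\<^esub> y) = F x \<oplus>\<^bsub>W\<^esub> F y"
    and "\<And>c x. c \<in> K \<Longrightarrow> x \<in> carrier V \<Longrightarrow> F (c \<odot>\<^bsub>V\<^esub> x) = c \<odot>\<^bsub>W\<^esub> F x"
  shows "linear_map K V W F"
  using assms by (auto simp: linear_map_def)

text \<open>\<open>bounded_operator\<close> prescribes no sign for its constant, but composing two
  estimates multiplies one of them by the constant of the other. Norms on \<open>V\<close> are
  nonnegative, so \<open>max C 0\<close> still bounds.\<close>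

lemma bounded_operator_pos_bound:
  assumes "hilbert_space K V" "bounded_operator K V W F"
  obtains C where "C \<ge> 0" "\<And>x. x \<in> carrier V \<Longrightarrow> hnorm W (F x) \<le> C * hnorm V x"
proof -
  interpret V: hilbert_space K V by fact
  obtain C where C: "\<And>x. x \<in> carrier V \<Longrightarrow> hnorm W (F x) \<le> C * hnorm V x"
    using assms(2) unfolding bounded_operator_def by blast
  have "hnorm W (F x) \<le> max C 0 * hnorm V x" if "x \<in> carrier V" for x
    using C[OF that] mult_right_mono[of C "max C 0" "hnorm V x"] that by simp
  then show thesis by (intro that[of "max C 0"]) auto
qed

lemma bounded_operator_compose:
  assumes "hilbert_space K V" "hilbert_space K W"
    and "bounded_operator K V W F" "bounded_operator K W P G"
  shows "bounded_operator K V P (\<lambda>x. G (F x))"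
proof -
  have F: "linear_map K V W F" and G: "linear_map K W P G"
    using assms(3,4) by (simp_all add: bounded_operator_def)
  note F = linear_mapD[OF F] and G = linear_mapD[OF G]
  obtain C where C: "\<And>x. x \<in> carrier V \<Longrightarrow> hnorm W (F x) \<le> C * hnorm V x"
    using bounded_operator_pos_bound[OF assms(1,3)] by blast
  obtain D where D: "D \<ge> 0" "\<And>x. x \<in> carrier W \<Longrightarrow> hnorm P (G x) \<le> D * hnorm W x"
    using bounded_operator_pos_bound[OF assms(2,4)] by blast
  have "hnorm P (G (F x)) \<le> D * C * hnorm V x" if "x \<in> carrier V" for x
    using D(2)[OF F(1)[OF that]] mult_left_mono[OF C[OF that] D(1)] by (simp add: mult.assoc)
  moreover have "linear_map K V P (\<lambda>x. G (F x))" by (rule linear_mapI) (simp_all add: F G)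
  ultimately show ?thesis by (auto simp: bounded_operator_def)
qed

lemma bounded_operator_fst:
  assumes "hilbert_space K X" "hilbert_space K Y"
  shows "bounded_operator K (hprod X Y) X fst"
proof -
  interpret Y: hilbert_space K Y by fact
  have "linear_map K (hprod X Y) X fst" by (rule linear_mapI) auto
  moreover have "hnorm X (fst p) \<le> 1 * hnorm (hprod X Y) p" if "p \<in> carrier (hprod X Y)" for p
    using that by (auto simp: hnorm_def)
  ultimately show ?thesis unfolding bounded_operator_def by blast
qed

lemma bounded_operator_snd:
  assumes "hilbert_space K X" "hilbert_space K Y"
  shows "bounded_operator K (hprod X Y) Y snd"
proof -
  interpret X: hilbert_space K X by fact
  have "linear_map K (hprod X Y) Y snd" by (rule linear_mapI) auto
  moreover have "hnorm Y (snd p) \<le> 1 * hnorm (hprod X Y) p" if "p \<in> carrier (hprod X Y)" for p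
    using that by (auto simp: hnorm_def)
  ultimately show ?thesis unfolding bounded_operator_def by blast
qed

text \<open>This is sqrt (a + b) \<le> sqrt a + sqrt b for the squared norms of the two components.
  It lets the bounds of two operators add up when they are paired.\<close>

lemma hnorm_hprod_le:
  assumes "hilbert_space K X" "hilbert_space K Y" "p \<in> carrier (hprod X Y)"
  shows "hnorm (hprod X Y) p \<le> hnorm X (fst p) + hnorm Y (snd p)"
proof -
  interpret X: hilbert_space K X by fact
  interpret Y: hilbert_space K Y by fact
  show ?thesis
    using assms(3) sqrt_add_le_add_sqrt[of "Re (hinner X (fst p) (fst p))" "Re (hinner Y (snd p) (snd p))"]
    by (auto simp: hnorm_def)
qed

lemma bounded_operator_pair:
  assumes "hilbert_space K V" "hilbert_space K X" "hilbert_space K Y"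
    and "bounded_operator K V X F" "bounded_operator K V Y G"
  shows "bounded_operator K V (hprod X Y) (\<lambda>x. (F x, G x))"
proof -
  have F: "linear_map K V X F" and G: "linear_map K V Y G"
    using assms(4,5) by (simp_all add: bounded_operator_def)
  note F = linear_mapD[OF F] and G = linear_mapD[OF G]
  obtain C where C: "\<And>x. x \<in> carrier V \<Longrightarrow> hnorm X (F x) \<le> C * hnorm V x"
    using bounded_operator_pos_bound[OF assms(1,4)] by blast
  obtain D where D: "\<And>x. x \<in> carrier V \<Longrightarrow> hnorm Y (G x) \<le> D * hnorm V x"
    using bounded_operator_pos_bound[OF assms(1,5)] by blast
  have "hnorm (hprod X Y) (F x, G x) \<le> (C + D) * hnorm V x" if "x \<in> carrier V" for x
    using hnorm_hprod_le[OF assms(2,3), of "(F x, G x)"] C[OF that] D[OF that] F(1) G(1) that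
    by (simp add: algebra_simps)
  moreover have "linear_map K V (hprod X Y) (\<lambda>x. (F x, G x))"
    by (rule linear_mapI) (simp_all add: F G)
  ultimately show ?thesis by (auto simp: bounded_operator_def)
qed

text \<open>Updating \<open>carrier\<close> keeps the inner product and the operations, so the same
  estimate serves on the subset.\<close>

lemma bounded_operator_restrict:
  assumes "bounded_operator K V W F" "S \<subseteq> carrier V"
  shows "bounded_operator K (V\<lparr>carrier := S\<rparr>) W F"
proof -
  have "hnorm (V\<lparr>carrier := S\<rparr>) x = hnorm V x" for x by (simp add: hnorm_def)
  moreover have "linear_map K (V\<lparr>carrier := S\<rparr>) W F"
    using assms by (auto simp: bounded_operator_def linear_map_def subset_iff)
  ultimately show ?thesis using assms unfolding bounded_operator_def by (auto simp: subset_iff)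
qed

section \<open>Equalizers as closed subspaces, and the relation
  \<open>A O B\<inverse>\<close>\<close>

lemma equalizer_submodule:
  assumes "hilbert_space K V" "hilbert_space K W" "linear_map K V W F" "linear_map K V W G"
  shows "submodule {x \<in> carrier V. F x = G x} (scalar_field K) V"
proof -
  interpret V: hilbert_space K V by fact
  interpret W: hilbert_space K W by fact
  note F = linear_mapD[OF assms(3)] and G = linear_mapD[OF assms(4)]
  note Fm = linear_map_minus[OF assms(1,2,3)] and Gm = linear_map_minus[OF assms(1,2,4)]
  have zero: "F \<zero>\<^bsub>V\<^esub> = \<zero>\<^bsub>W\<^esub>" "G \<zero>\<^bsub>V\<^esub> = \<zero>\<^bsub>W\<^esub>"
    using Fm[of "\<zero>\<^bsub>V\<^esub>" "\<zero>\<^bsub>V\<^esub>"] Gm[of "\<zero>\<^bsub>V\<^esub>" "\<zero>\<^bsub>V\<^esub>"] F(1) G(1) by (simp_all add: a_minus_def V.M.r_neg W.M.r_neg)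
  \<comment> \<open>The negative is read as zero minus \<open>x\<close>, so that compatibility with
    subtraction applies.\<close>
  have neg: "F (\<ominus>\<^bsub>V\<^esub> x) = G (\<ominus>\<^bsub>V\<^esub> x)" if "x \<in> carrier V" "F x = G x" for x
    using Fm[of "\<zero>\<^bsub>V\<^esub>" x] Gm[of "\<zero>\<^bsub>V\<^esub>" x] that zero by (simp add: a_minus_def)
  show ?thesis by (rule V.submoduleI) (auto simp: zero neg F G)
qed

text \<open>Continuity of \<open>F\<close> and \<open>G\<close> makes the equalizer closed in
  \<open>V\<close>, and a closed subspace of a complete space is complete. Speaking of an equalizer
  rather than of the kernel of \<open>F\<close> minus \<open>G\<close> avoids constructing the
  difference operator.\<close>

lemma equalizer_hilbert_space:
  assumes "hilbert_space K V" "hilbert_space K W" "bounded_operator K V W F" "bounded_operator K V W G"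
  shows "hilbert_space K (V\<lparr>carrier := {x \<in> carrier V. F x = G x}\<rparr>)"
proof -
  interpret V: hilbert_space K V by fact
  interpret W: hilbert_space K W by fact
  have linF: "linear_map K V W F" and linG: "linear_map K V W G"
    using assms(3,4) by (simp_all add: bounded_operator_def)
  note F = linear_mapD[OF linF] and G = linear_mapD[OF linG]
  note Fm = linear_map_minus[OF assms(1,2) linF] and Gm = linear_map_minus[OF assms(1,2) linG]
  define E where "E = {x \<in> carrier V. F x = G x}"
  have E: "x \<in> carrier V" "F x = G x" if "x \<in> E" for x using that by (auto simp: E_def)
  have sub: "submodule E (scalar_field K) V"
    unfolding E_def by (rule equalizer_submodule) fact+
  note subE = V.submoduleE[OF sub, simplified]
  let ?U = "V\<lparr>carrier := E\<rparr>"
  have mod: "module (scalar_field K) ?U"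
    using submodule.submodule_is_module[OF sub V.module_axioms] .
  interpret U: module "scalar_field K" ?U by (fact mod)
  have nU: "hnorm ?U x = hnorm V x" for x by (simp add: hnorm_def)
  \<comment> \<open>Additive inverses are defined relative to the carrier, so subtraction in the
    subspace must first be identified with subtraction in \<open>V\<close>; uniqueness of inverses
    does this.\<close>
  have minusU: "x \<ominus>\<^bsub>?U\<^esub> y = x \<ominus>\<^bsub>V\<^esub> y" if "x \<in> E" "y \<in> E" for x y
  proof -
    have "\<ominus>\<^bsub>?U\<^esub> y = \<ominus>\<^bsub>V\<^esub> y"
      by (rule U.minus_equality) (use that subE E in \<open>auto simp: V.M.l_neg\<close>)
    then show ?thesis by (simp add: a_minus_def)
  qed
  have "hilbert_space K ?U"
  proof (intro hilbert_space.intro[OF mod] hilbert_space_axioms.intro)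
    show "K = \<real> \<or> K = UNIV" by (fact V.scalars)
  next
    fix x y assume "x \<in> carrier ?U" "y \<in> carrier ?U"
    then show "hinner ?U x y = cnj (hinner ?U y x)" using V.hinner_commute[of x y] E by simp
  next
    fix s :: "nat \<Rightarrow> 'a" assume s: "\<And>n. s n \<in> carrier ?U"
      and Cauchy: "\<And>e. e > 0 \<Longrightarrow> \<exists>N. \<forall>i\<ge>N. \<forall>j\<ge>N. hnorm ?U (s i \<ominus>\<^bsub>?U\<^esub> s j) < e"
    have sE: "s n \<in> E" for n using s by simp
    note sV = E[OF sE]
    have "\<exists>l\<in>carrier V. (\<lambda>n. hnorm V (s n \<ominus>\<^bsub>V\<^esub> l)) \<longlonglongrightarrow> 0"
      using Cauchy by (intro V.complete) (simp_all add: sV minusU sE nU)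
    then obtain l where l: "l \<in> carrier V" and lim: "(\<lambda>n. hnorm V (s n \<ominus>\<^bsub>V\<^esub> l)) \<longlonglongrightarrow> 0" by blast
    obtain C where C: "\<And>x. x \<in> carrier V \<Longrightarrow> hnorm W (F x) \<le> C * hnorm V x"
      using bounded_operator_pos_bound[OF assms(1,3)] by blast
    obtain D where D: "\<And>x. x \<in> carrier V \<Longrightarrow> hnorm W (G x) \<le> D * hnorm V x"
      using bounded_operator_pos_bound[OF assms(1,4)] by blast
    have "hnorm W (F l \<ominus>\<^bsub>W\<^esub> G l) \<le> (C + D) * hnorm V (s n \<ominus>\<^bsub>V\<^esub> l)" for n
    proof -
      \<comment> \<open>Insert the common value \<open>F (s n)\<close> = \<open>G (s n)\<close>,
        available because \<open>s n\<close> lies in \<open>E\<close>. Each of the two differences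
        is then the image of \<open>s n\<close> minus \<open>l\<close>, up to order.\<close>
      have "F l \<ominus>\<^bsub>W\<^esub> G l = (F l \<ominus>\<^bsub>W\<^esub> F (s n)) \<oplus>\<^bsub>W\<^esub> (G (s n) \<ominus>\<^bsub>W\<^esub> G l)"
        using W.minus_a_assoc[of "F l" "F (s n)" "G l"] sV l F(1) G(1) by metis
      then have "hnorm W (F l \<ominus>\<^bsub>W\<^esub> G l) \<le> hnorm W (F l \<ominus>\<^bsub>W\<^esub> F (s n)) + hnorm W (G (s n) \<ominus>\<^bsub>W\<^esub> G l)"
        using sV l F(1) G(1) by (simp add: W.hnorm_triangle)
      also have "\<dots> = hnorm W (F (s n \<ominus>\<^bsub>V\<^esub> l)) + hnorm W (G (s n \<ominus>\<^bsub>V\<^esub> l))"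
        using Fm[OF sV(1) l] Gm[OF sV(1) l] W.hnorm_minus_commute[OF F(1)[OF l] F(1)[OF sV(1)]] by simp
      also have "\<dots> \<le> (C + D) * hnorm V (s n \<ominus>\<^bsub>V\<^esub> l)"
        using C[of "s n \<ominus>\<^bsub>V\<^esub> l"] D[of "s n \<ominus>\<^bsub>V\<^esub> l"] sV(1) l by (simp add: distrib_right)
      finally show ?thesis .
    qed
    moreover have "(\<lambda>n. (C + D) * hnorm V (s n \<ominus>\<^bsub>V\<^esub> l)) \<longlonglongrightarrow> 0"
      using tendsto_mult_right_zero[OF lim] .
    \<comment> \<open>The left side does not depend on \<open>n\<close>, so it is bounded by the
      limit 0 of the right side.\<close>
    ultimately have "hnorm W (F l \<ominus>\<^bsub>W\<^esub> G l) \<le> 0" by (intro LIMSEQ_le_const) auto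
    then have "F l \<ominus>\<^bsub>W\<^esub> G l = \<zero>\<^bsub>W\<^esub>"
      using W.hnorm_eq_0 W.hnorm_ge_0 F(1)[OF l] G(1)[OF l] by (metis W.M.minus_closed order_antisym)
    then have "F l = G l" using W.minus_add_cancel[OF F(1)[OF l] G(1)[OF l]] G(1)[OF l] by simp
    then have "l \<in> E" using l by (simp add: E_def)
    then show "\<exists>l\<in>carrier ?U. (\<lambda>n. hnorm ?U (s n \<ominus>\<^bsub>?U\<^esub> l)) \<longlonglongrightarrow> 0"
      using lim by (intro bexI[of _ l]) (simp_all add: minusU nU sE)
  qed (simp_all add: E V.hinner_in V.hinner_add_left V.hinner_smult_left V.hinner_pos)
  then show ?thesis by (simp add: E_def)
qed

lemma range_space_relation_comp_converse:
  fixes X :: "'x hspace" and Y :: "'y hspace" and Z :: "'z hspace"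
  assumes X: "hilbert_space K X" and Y: "hilbert_space K Y" and Z: "hilbert_space K Z"
    and "range_space_relation K X Z A" "range_space_relation K Y Z B"
  shows "range_space_relation K X Y (A O B\<inverse>)"
proof -
  obtain V :: "('x \<times> 'z) hspace" and F where V: "hilbert_space K V"
    and F: "bounded_operator K V (hprod X Z) F" and A: "F ` carrier V = A"
    using assms(4) unfolding range_space_relation_def by blast
  obtain W :: "('y \<times> 'z) hspace" and G where W: "hilbert_space K W"
    and G: "bounded_operator K W (hprod Y Z) G" and B: "G ` carrier W = B"
    using assms(5) unfolding range_space_relation_def by blast
  note XZ = hprod_hilbert_space[OF X Z] and YZ = hprod_hilbert_space[OF Y Z]
    and VW = hprod_hilbert_space[OF V W]
  note Ffst = bounded_operator_compose[OF VW V bounded_operator_fst[OF V W] F]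
  note Gsnd = bounded_operator_compose[OF VW W bounded_operator_snd[OF V W] G]
  \<comment> \<open>The four components of \<open>F\<close> and \<open>G\<close>, all as operators
    on the one space \<open>hprod V W\<close>: \<open>F2\<close> and \<open>G2\<close> both map to
    \<open>Z\<close> and cut out the domain, while \<open>F1\<close> and \<open>G1\<close> are
    paired into \<open>H\<close>.\<close>
  note F1 = bounded_operator_compose[OF VW XZ Ffst bounded_operator_fst[OF X Z]]
    and F2 = bounded_operator_compose[OF VW XZ Ffst bounded_operator_snd[OF X Z]]
    and G1 = bounded_operator_compose[OF VW YZ Gsnd bounded_operator_fst[OF Y Z]]
    and G2 = bounded_operator_compose[OF VW YZ Gsnd bounded_operator_snd[OF Y Z]]
  define E where "E = {p \<in> carrier (hprod V W). snd (F (fst p)) = snd (G (snd p))}"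
  define H where "H p = (fst (F (fst p)), fst (G (snd p)))" for p
  let ?U = "(hprod V W)\<lparr>carrier := E\<rparr>"
  have "hilbert_space K ?U"
    unfolding E_def by (rule equalizer_hilbert_space[OF VW Z F2 G2])
  moreover have "bounded_operator K ?U (hprod X Y) H"
    unfolding H_def by (rule bounded_operator_restrict[OF bounded_operator_pair[OF VW X Y F1 G1]])
      (simp add: E_def)
  \<comment> \<open>The domain of \<open>H\<close> lives over
    \<open>('x \<times> 'z) \<times> ('y \<times> 'z)\<close>, whereas the definition asks for a
    space over \<open>'x \<times> 'y\<close>; \<open>range_space_relationI\<close> provides the
    transport.\<close>
  ultimately have "range_space_relation K X Y (H ` carrier ?U)"
    by (rule range_space_relationI[OF X Y])
  moreover have "H ` E = A O B\<inverse>"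
  proof
    show "H ` E \<subseteq> A O B\<inverse>"
    proof
      fix q assume "q \<in> H ` E"
      then obtain u v where uv: "u \<in> carrier V" "v \<in> carrier W" "snd (F u) = snd (G v)"
        and q: "q = (fst (F u), fst (G v))"
        by (auto simp: E_def H_def)
      \<comment> \<open>The shared value \<open>snd (F u)\<close> is the intermediate point in
        \<open>Z\<close> through which the composition passes.\<close>
      have "(fst (F u), snd (F u)) \<in> A" "(fst (G v), snd (F u)) \<in> B"
        using imageI[OF uv(1), of F] imageI[OF uv(2), of G]
        by (simp_all only: A B uv(3)[symmetric] prod.collapse) (simp only: uv(3) prod.collapse)
      then show "q \<in> A O B\<inverse>" unfolding q by blast
    qed
    show "A O B\<inverse> \<subseteq> H ` E"
    proof clarify
      fix x y z assume "(x, z) \<in> A" "(y, z) \<in> B"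
      then obtain u v where "u \<in> carrier V" "(x, z) = F u" "v \<in> carrier W" "(y, z) = G v"
        unfolding A[symmetric] B[symmetric] by (elim imageE)
      note this(1,3) this(2,4)[symmetric]
      then show "(x, y) \<in> H ` E" by (intro image_eqI[of _ _ "(u, v)"]) (simp_all add: E_def H_def)
    qed
  qed
  ultimately show ?thesis by simp
qed

section \<open>Algebra of linear relations and the equivalence\<close>

text \<open>The submodule laws of the product space in componentwise form, so that the equivalence
  can be proved by adding and subtracting pairs.\<close>

lemma linear_relationD:
  assumes "hilbert_space K X" "hilbert_space K Y" "linear_relation K X Y A"
  shows "(x, y) \<in> A \<Longrightarrow> x \<in> carrier X" "(x, y) \<in> A \<Longrightarrow> y \<in> carrier Y"
    and "(\<zero>\<^bsub>X\<^esub>, \<zero>\<^bsub>Y\<^esub>) \<in> A"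
    and "(x, y) \<in> A \<Longrightarrow> (x', y') \<in> A \<Longrightarrow> (x \<oplus>\<^bsub>X\<^esub> x', y \<oplus>\<^bsub>Y\<^esub> y') \<in> A"
    and "(x, y) \<in> A \<Longrightarrow> (x', y') \<in> A \<Longrightarrow> (x \<ominus>\<^bsub>X\<^esub> x', y \<ominus>\<^bsub>Y\<^esub> y') \<in> A"
proof -
  interpret X: hilbert_space K X by fact
  interpret Y: hilbert_space K Y by fact
  interpret P: hilbert_space K "hprod X Y" by (rule hprod_hilbert_space) fact+
  note E = P.submoduleE[OF assms(3)[unfolded linear_relation_def], simplified]
  show carrier: "x \<in> carrier X" "y \<in> carrier Y" if "(x, y) \<in> A" for x y
    using that E(1) by auto
  show add: "(x \<oplus>\<^bsub>X\<^esub> x', y \<oplus>\<^bsub>Y\<^esub> y') \<in> A" if "(x, y) \<in> A" "(x', y') \<in> A" for x y x' y'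
    using E(5)[OF that] by simp
  have neg: "(\<ominus>\<^bsub>X\<^esub> x, \<ominus>\<^bsub>Y\<^esub> y) \<in> A" if "(x, y) \<in> A" for x y
  proof -
    \<comment> \<open>The componentwise negative is an additive inverse in the product, hence the
      only one.\<close>
    have "\<ominus>\<^bsub>hprod X Y\<^esub> (x, y) = (\<ominus>\<^bsub>X\<^esub> x, \<ominus>\<^bsub>Y\<^esub> y)"
      by (rule P.M.minus_equality) (use carrier[OF that] in \<open>auto simp: X.M.l_neg Y.M.l_neg\<close>)
    then show ?thesis using E(3)[OF that] by simp
  qed
  show diff: "(x \<ominus>\<^bsub>X\<^esub> x', y \<ominus>\<^bsub>Y\<^esub> y') \<in> A" if "(x, y) \<in> A" "(x', y') \<in> A" for x y x' y'
    using add[OF that(1) neg[OF that(2)]] by (simp add: a_minus_def)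
  obtain a b where "(a, b) \<in> A" using E(2) by auto
  then show "(\<zero>\<^bsub>X\<^esub>, \<zero>\<^bsub>Y\<^esub>) \<in> A"
    using diff[of a b a b] carrier[of a b] by (simp add: a_minus_def X.M.r_neg Y.M.r_neg)
qed

theorem corollary2p2:
  fixes K :: "complex set"
    and X :: "'x hspace" and Y :: "'y hspace" and Z :: "'z hspace"
    and A :: "('x \<times> 'z) set" and B :: "('y \<times> 'z) set"
  assumes "hilbert_space K X" and "hilbert_space K Y" and "hilbert_space K Z"
    and "range_space_relation K X Z A" and "range_space_relation K Y Z B"
  shows "(range_space_operator K X Y (A O B\<inverse>) \<and> A = (A O B\<inverse>) O B) \<longleftrightarrow>
         (Range A \<subseteq> Range B \<and> mul_rel Y B = mul_rel X A \<and> ker_rel Z B = {\<zero>\<^bsub>Y\<^esub>})"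
proof -
  interpret X: hilbert_space K X by fact
  interpret Y: hilbert_space K Y by fact
  interpret Z: hilbert_space K Z by fact
  have linA: "linear_relation K X Z A" and linB: "linear_relation K Y Z B"
    using assms(4,5) by (simp_all add: range_space_relation_def)
  note A = linear_relationD[OF assms(1,3) linA] and B = linear_relationD[OF assms(2,3) linB]
  have "range_space_relation K X Y (A O B\<inverse>)"
    by (rule range_space_relation_comp_converse) fact+
  \<comment> \<open>Write T for \<open>A O B\<inverse>\<close>. Since T is always a range space
    relation, only single-valuedness and the equation remain to be characterized.\<close>
  then have operator_iff: "range_space_operator K X Y (A O B\<inverse>) \<longleftrightarrow> mul_rel X (A O B\<inverse>) = {\<zero>\<^bsub>Y\<^esub>}"
    using operator_graph_iff[OF assms(1,2)]
    by (simp add: range_space_operator_def range_space_relation_def)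
  show ?thesis unfolding operator_iff
  proof
    assume *: "mul_rel X (A O B\<inverse>) = {\<zero>\<^bsub>Y\<^esub>} \<and> A = (A O B\<inverse>) O B"
    then have mulT: "y = \<zero>\<^bsub>Y\<^esub>" if "(\<zero>\<^bsub>X\<^esub>, y) \<in> A O B\<inverse>" for y
      using that by (auto simp: mul_rel_def)
    have AB: "(x, z) \<in> A \<longleftrightarrow> (\<exists>y. (x, y) \<in> A O B\<inverse> \<and> (y, z) \<in> B)" for x z
      using * by blast
    have "Range A \<subseteq> Range B" using AB by blast
    moreover have "mul_rel Y B = mul_rel X A"
    proof -
      \<comment> \<open>The equation factors the pair in \<open>A\<close> through some
        \<open>y\<close> with (0, y) in T, and \<open>mulT\<close> forces that \<open>y\<close> to
        be zero.\<close>
      have "(\<zero>\<^bsub>Y\<^esub>, z) \<in> B" if "(\<zero>\<^bsub>X\<^esub>, z) \<in> A" for z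
        using that AB mulT by blast
      \<comment> \<open>Both \<open>A\<close> and \<open>B\<close> contain the zero pair, hence so
        does T; following it by (0, z) in \<open>B\<close> gives a pair of \<open>A\<close>.\<close>
      moreover have "(\<zero>\<^bsub>X\<^esub>, z) \<in> A" if "(\<zero>\<^bsub>Y\<^esub>, z) \<in> B" for z
        using that AB A(3) B(3) by blast
      ultimately show ?thesis by (auto simp: mul_rel_def)
    qed
    \<comment> \<open>If (y, 0) is in \<open>B\<close>, then (0, 0) in \<open>A\<close> yields (0,
      y) in T.\<close>
    moreover have "ker_rel Z B = {\<zero>\<^bsub>Y\<^esub>}"
      using mulT A(3) B(3) by (auto simp: ker_rel_def)
    ultimately show "Range A \<subseteq> Range B \<and> mul_rel Y B = mul_rel X A \<and> ker_rel Z B = {\<zero>\<^bsub>Y\<^esub>}"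
      by blast
  next
    assume *: "Range A \<subseteq> Range B \<and> mul_rel Y B = mul_rel X A \<and> ker_rel Z B = {\<zero>\<^bsub>Y\<^esub>}"
    then have mul: "(\<zero>\<^bsub>Y\<^esub>, z) \<in> B \<longleftrightarrow> (\<zero>\<^bsub>X\<^esub>, z) \<in> A" for z
      by (auto simp: mul_rel_def)
    have ker: "y = \<zero>\<^bsub>Y\<^esub>" if "(y, \<zero>\<^bsub>Z\<^esub>) \<in> B" for y
      using * that by (auto simp: ker_rel_def)
    have "y = \<zero>\<^bsub>Y\<^esub>" if "(\<zero>\<^bsub>X\<^esub>, z) \<in> A" "(y, z) \<in> B" for y z
    proof (rule ker)
      \<comment> \<open>The equality of multivalued parts puts (0, z) into \<open>B\<close> as well;
        subtracting it from (y, z) leaves an element of the kernel.\<close>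
      have "(y \<ominus>\<^bsub>Y\<^esub> \<zero>\<^bsub>Y\<^esub>, z \<ominus>\<^bsub>Z\<^esub> z) \<in> B" using that B(5) mul by blast
      then show "(y, \<zero>\<^bsub>Z\<^esub>) \<in> B"
        using B(1,2)[OF that(2)] Y.minus_add_cancel[of y "\<zero>\<^bsub>Y\<^esub>"] by (simp add: a_minus_def[of Z] Z.M.r_neg)
    qed
    then have "mul_rel X (A O B\<inverse>) = {\<zero>\<^bsub>Y\<^esub>}"
      unfolding mul_rel_def using A(3) B(3) by blast
    \<comment> \<open>The range inclusion supplies a \<open>y\<close> with (y, z) in
      \<open>B\<close>; the path goes from \<open>z\<close> back to \<open>y\<close> and returns to
      \<open>z\<close>.\<close>
    moreover have "A \<subseteq> (A O B\<inverse>) O B"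
    proof (rule subrelI)
      fix x z assume xz: "(x, z) \<in> A"
      then have "z \<in> Range B" using conjunct1[OF *] by (rule subsetD[OF _ RangeI, rotated])
      then obtain y where "(y, z) \<in> B" by (rule RangeE)
      then show "(x, z) \<in> (A O B\<inverse>) O B" using xz by blast
    qed
    \<comment> \<open>A path may return to a point \<open>z\<close> other than \<open>z'\<close>.
      The two differ by an element of the multivalued part of \<open>B\<close>, which is that of
      \<open>A\<close>, so adding this difference to (x, z') stays in \<open>A\<close>.\<close>
    moreover have "(x, z) \<in> A" if "(x, z') \<in> A" "(y, z') \<in> B" "(y, z) \<in> B" for x y z z'
    proof -
      have "(\<zero>\<^bsub>X\<^esub>, z \<ominus>\<^bsub>Z\<^esub> z') \<in> A"
        using B(5)[OF that(3,2)] B(1)[OF that(2)] mul by (simp add: a_minus_def Y.M.r_neg)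
      then have "(\<zero>\<^bsub>X\<^esub> \<oplus>\<^bsub>X\<^esub> x, (z \<ominus>\<^bsub>Z\<^esub> z') \<oplus>\<^bsub>Z\<^esub> z') \<in> A" using A(4) that(1) by blast
      then show ?thesis
        using A(1)[OF that(1)] B(2)[OF that(2)] B(2)[OF that(3)] by (simp add: Z.minus_add_cancel)
    qed
    then have "(A O B\<inverse>) O B \<subseteq> A" by blast
    ultimately show "mul_rel X (A O B\<inverse>) = {\<zero>\<^bsub>Y\<^esub>} \<and> A = (A O B\<inverse>) O B" by blast
  qed
qed

end
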